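(* Let $m\ge 0$ and $\alpha\in(0,2\pi)$ be real numbers. Let $\Gamma=\langle\iota_1,\iota_2,\iota_3\rangle\subset \mathrm{PU}(2,1)$ be a complex hyperbolic triangle group of type $[m,m,0;3,3,2]$ with angular invariant $\alpha$. If \[ \cos(\alpha)>1-\frac{1}{12\sqrt3\,\cosh^2\left(\frac m2\right)}, \] then $\Gamma$ is not discrete (as a subgroup of $\mathrm{PU}(2,1)$).
   Context: Let $\mathbb{C}^{2,1}$ be $\mathbb{C}^3$ with the Hermitian form $\langle z,w\rangle=z_1\bar w_1+z_2\bar w_2-z_3\bar w_3$. The complex hyperbolic plane $H^2_{\mathbb{C}}$ is the set of negative lines $[z]$ ($\langle z,z\rangle<0$) in the projectivisation, and its boundary $\partial H^2_{\mathbb{C}}$ is the set of null lines. The Bergman metric $\rho$ is given by $\cosh^2(\rho([z],[w])/2)=\frac{\langle z,w\rangle\langle w,z\rangle}{\langle z,z\rangle\langle w,w\rangle}$; the group of holomorphic isometries is $\mathrm{PU}(2,1)$. A complex geodesic is the projectivisation of $\{z:\langle c,z\rangle=0\}$ for a positive vector $c$ ($\langle c,c\rangle>0$), called a polar vector; $c$ is normalised if $\langle c,c\rangle=1$. Two complex geodesics $C,C'$ with normalised polar vectors $c,c'$ are ultra-parallel if they have no common point in $H^2_{\mathbb{C}}\cup\partial H^2_{\mathbb{C}}$; then $|\langle c,c'\rangle|=\cosh(\tfrac12\operatorname{dist}(C,C'))>1$. Two distinct complex geodesics are ideal if they meet in a point of $\partial H^2_{\mathbb{C}}$; then $|\langle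 c,c'\rangle|=1$ and $\operatorname{dist}(C,C')=0$. The minimal complex reflection of order $n$ in a complex geodesic $C$ with polar vector $c$ is the element of $\mathrm{PU}(2,1)$ given by $\iota(z)=-z+(1-\mu)\frac{\langle z,c\rangle}{\langle c,c\rangle}c$, where $\mu=\exp(2\pi i/n)$. An $[m_1,m_2,m_3]$-triangle is a triple $(C_1,C_2,C_3)$ of complex geodesics that are pairwise ultra-parallel or ideal, with $m_k=\operatorname{dist}(C_{k-1},C_{k+1})$ for $k=1,2,3$ (indices mod 3; $m_k=0$ is the ideal case). Its angular invariant is $\alpha=\arg\left(\prod_{k=1}^3\langle c_{k-1},c_{k+1}\rangle\right)$, where $c_k$ is a normalised polar vector of $C_k$ (indices mod 3; this does not depend on the choice of the $c_k$). A complex hyperbolic triangle group of type $[m_1,m_2,m_3;n_1,n_2,n_3]$ with angular invariant $\alpha$ is the subgroup of $\mathrm{PU}(2,1)$ generated by the minimal complex reflections $\iota_k$ of order $n_k$ in $C_k$, $k=1,2,3$, for an $[m_1,m_2,m_3]$-triangle $(C_1,C_2,C_3)$ with angular invariant $\alpha$. So for type $[m,m,0;3,3,2]$: $\iota_1,\iota_2$ have order 3, $\iota_3$ has order 2, $\operatorname{dist}(C_2,C_3)=\operatorname{dist}(C_1,C_3)=m$, and $C_1,C_2$ are ideal. *)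

theory Defs
  imports "HOL-Analysis.Analysis" "HOL-Algebra.Coset" "HOL-Algebra.Generated_Groups"
begin

definition herm :: "complex^3 \<Rightarrow> complex^3 \<Rightarrow> complex" where
  "herm z w = z $ 1 * cnj (w $ 1) + z $ 2 * cnj (w $ 2) - z $ 3 * cnj (w $ 3)"

text \<open>A point of the projective plane is a complex line, i.e. the set
  \<^term>\<open>vec.span {z}\<close> of all complex multiples of some \<^term>\<open>z \<noteq> 0\<close>.
  The values \<^term>\<open>herm z z\<close> are real, so their sign is read off from the real part.\<close>

abbreviation cline :: "complex^3 \<Rightarrow> (complex^3) set" where
  "cline z \<equiv> vec.span {z}"

definition hyp_plane :: "(complex^3) set set" where
  "hyp_plane = {cline z | z. Re (herm z z) < 0}"

definition hyp_boundary :: "(complex^3) set set" where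
  "hyp_boundary = {cline z | z. z \<noteq> 0 \<and> herm z z = 0}"

definition bergman :: "(complex^3) set \<Rightarrow> (complex^3) set \<Rightarrow> real" where
  "bergman p q = (THE r. 0 \<le> r \<and>
     (\<forall>z \<in> p - {0}. \<forall>w \<in> q - {0}.
        complex_of_real ((cosh (r / 2))\<^sup>2) = herm z w * herm w z / (herm z z * herm w w)))"

text \<open>A complex geodesic is the full projective line polar to a positive vector; it also contains
  points outside the closure of the hyperbolic plane.\<close>

definition polar_line :: "complex^3 \<Rightarrow> (complex^3) set set" where
  "polar_line c = {cline z | z. z \<noteq> 0 \<and> herm c z = 0}"

definition complex_geodesic :: "(complex^3) set set \<Rightarrow> bool" where
  "complex_geodesic C \<longleftrightarrow> (\<exists>c. Re (herm c c) > 0 \<and> C = polar_line c)"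

definition normalised_polar :: "complex^3 \<Rightarrow> (complex^3) set set \<Rightarrow> bool" where
  "normalised_polar c C \<longleftrightarrow> herm c c = 1 \<and> C = polar_line c"

definition ultra_parallel :: "(complex^3) set set \<Rightarrow> (complex^3) set set \<Rightarrow> bool" where
  "ultra_parallel C C' \<longleftrightarrow> C \<inter> C' \<inter> (hyp_plane \<union> hyp_boundary) = {}"

definition ideal_pair :: "(complex^3) set set \<Rightarrow> (complex^3) set set \<Rightarrow> bool" where
  "ideal_pair C C' \<longleftrightarrow> C \<noteq> C' \<and> C \<inter> C' \<inter> hyp_boundary \<noteq> {}"

definition geodesic_dist :: "(complex^3) set set \<Rightarrow> (complex^3) set set \<Rightarrow> real" where
  "geodesic_dist C C' = Inf {bergman p q | p q. p \<in> C \<inter> hyp_plane \<and> q \<in> C' \<inter> hyp_plane}"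

definition is_triangle ::
    "real \<Rightarrow> real \<Rightarrow> real \<Rightarrow> (complex^3) set set \<Rightarrow> (complex^3) set set \<Rightarrow> (complex^3) set set \<Rightarrow> bool" where
  "is_triangle m1 m2 m3 C1 C2 C3 \<longleftrightarrow>
     complex_geodesic C1 \<and> complex_geodesic C2 \<and> complex_geodesic C3 \<and>
     (ultra_parallel C3 C2 \<or> ideal_pair C3 C2) \<and>
     (ultra_parallel C1 C3 \<or> ideal_pair C1 C3) \<and>
     (ultra_parallel C2 C1 \<or> ideal_pair C2 C1) \<and>
     m1 = geodesic_dist C3 C2 \<and> m2 = geodesic_dist C1 C3 \<and> m3 = geodesic_dist C2 C1"

text \<open>The argument is taken in \<open>[0, 2\<pi>)\<close>.\<close>

definition angular_invariant :: "complex^3 \<Rightarrow> complex^3 \<Rightarrow> complex^3 \<Rightarrow> real" where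
  "angular_invariant c1 c2 c3 = Arg2pi (herm c3 c2 * herm c1 c3 * herm c2 c1)"

definition U21 :: "(complex^3^3) monoid" where
  "U21 = \<lparr>carrier = {A. \<forall>z w. herm (A *v z) (A *v w) = herm z w}, mult = (**), one = mat 1\<rparr>"

definition U21_scalars :: "(complex^3^3) set" where
  "U21_scalars = {mat a | a. cmod a = 1}"

definition PU21 :: "(complex^3^3) set monoid" where
  "PU21 = U21 Mod U21_scalars"

definition PU21_class :: "complex^3^3 \<Rightarrow> (complex^3^3) set" where
  "PU21_class A = r_coset U21 U21_scalars A"

text \<open>The quotient topology induced by the projection from the unitary group
  (see \<open>quotient_map_PU21_class\<close> below).\<close>

definition PU21_topology :: "(complex^3^3) set topology" where
  "PU21_topology = topology (\<lambda>S. S \<subseteq> carrier PU21 \<and>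
     openin (top_of_set (carrier U21)) {A \<in> carrier U21. PU21_class A \<in> S})"

definition discrete_in_PU21 :: "(complex^3^3) set set \<Rightarrow> bool" where
  "discrete_in_PU21 \<Gamma> \<longleftrightarrow> subtopology PU21_topology \<Gamma> = discrete_topology \<Gamma>"

definition reflection_map :: "nat \<Rightarrow> complex^3 \<Rightarrow> complex^3 \<Rightarrow> complex^3" where
  "reflection_map n c z =
     - z + ((1 - exp (2 * of_real pi * \<i> / of_nat n)) * (herm z c / herm c c)) *s c"

definition minimal_reflection :: "nat \<Rightarrow> complex^3 \<Rightarrow> (complex^3^3) set" where
  "minimal_reflection n c = PU21_class (matrix (reflection_map n c))"

definition is_triangle_group ::
    "real \<Rightarrow> real \<Rightarrow> real \<Rightarrow> nat \<Rightarrow> nat \<Rightarrow> nat \<Rightarrow> real \<Rightarrow> (complex^3^3) set set \<Rightarrow> bool" where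
  "is_triangle_group m1 m2 m3 n1 n2 n3 \<alpha> \<Gamma> \<longleftrightarrow>
     (\<exists>C1 C2 C3 c1 c2 c3. is_triangle m1 m2 m3 C1 C2 C3 \<and>
        normalised_polar c1 C1 \<and> normalised_polar c2 C2 \<and> normalised_polar c3 C3 \<and>
        \<alpha> = angular_invariant c1 c2 c3 \<and>
        \<Gamma> = generate PU21
              {minimal_reflection n1 c1, minimal_reflection n2 c2, minimal_reflection n3 c3})"

lemma herm_add_left: "herm (x + y) z = herm x z + herm y z"
  and herm_scale_left: "herm (a *s x) z = a * herm x z"
  and herm_minus_left: "herm (- x) z = - herm x z"
  and herm_add_right: "herm z (x + y) = herm z x + herm z y"
  and herm_scale_right: "herm z (a *s x) = cnj a * herm z x"
  and herm_minus_right: "herm z (- x) = - herm z x"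
  and herm_cnj: "cnj (herm x z) = herm z x"
  by (simp_all add: herm_def algebra_simps)

lemma herm_zero_left: "herm 0 w = 0"
  by (simp add: herm_def)

lemma reverse_cauchy_schwarz:
  assumes z: "Re (herm z z) < 0" and w: "Re (herm w w) < 0"
  shows "Re (herm z z) * Re (herm w w) \<le> (cmod (herm z w))\<^sup>2"
proof -
  define p q r where "p = cmod (z $ 1)" and "q = cmod (z $ 2)" and "r = cmod (z $ 3)"
  define s t u where "s = cmod (w $ 1)" and "t = cmod (w $ 2)" and "u = cmod (w $ 3)"
  note d = p_def q_def r_def s_def t_def u_def
  have zz: "Re (herm z z) = p\<^sup>2 + q\<^sup>2 - r\<^sup>2" and ww: "Re (herm w w) = s\<^sup>2 + t\<^sup>2 - u\<^sup>2"
    unfolding d herm_def cmod_power2 by (simp_all add: power2_eq_square)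
  have nn: "p \<ge> 0" "q \<ge> 0" "r \<ge> 0" "s \<ge> 0" "t \<ge> 0" "u \<ge> 0" by (simp_all add: d)
  define a b where "a = sqrt (p\<^sup>2 + q\<^sup>2)" and "b = sqrt (s\<^sup>2 + t\<^sup>2)"
  have a: "a \<ge> 0" "a\<^sup>2 = p\<^sup>2 + q\<^sup>2" and b: "b \<ge> 0" "b\<^sup>2 = s\<^sup>2 + t\<^sup>2"
    by (auto simp: a_def b_def)
  have ar: "a < r" using z zz a nn by (intro power2_less_imp_less[of a r]) auto
  have bu: "b < u" using w ww b nn by (intro power2_less_imp_less[of b u]) auto
  have "(a * b)\<^sup>2 - (p * s + q * t)\<^sup>2 = (p * t - q * s)\<^sup>2"
    using a b by (simp add: power_mult_distrib) (simp add: power2_eq_square algebra_simps)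
  then have "(p * s + q * t)\<^sup>2 \<le> (a * b)\<^sup>2" by (smt (verit) zero_le_power2)
  then have cs: "p * s + q * t \<le> a * b" by (rule power2_le_imp_le) (simp add: a(1) b(1))
  have "cmod (z $ 1 * cnj (w $ 1) + z $ 2 * cnj (w $ 2)) \<le> p * s + q * t"
    by (rule order_trans[OF norm_triangle_ineq]) (simp add: d norm_mult)
  moreover have "cmod (z $ 3 * cnj (w $ 3)) = r * u" by (simp add: d norm_mult)
  moreover have "cmod (z $ 3 * cnj (w $ 3)) - cmod (z $ 1 * cnj (w $ 1) + z $ 2 * cnj (w $ 2))
      \<le> cmod (herm z w)"
    unfolding herm_def by (metis norm_minus_commute norm_triangle_ineq2)
  ultimately have le: "r * u - a * b \<le> cmod (herm z w)" using cs by linarith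
  have "0 \<le> r * u - a * b" using mult_mono[of a r b u] ar bu a(1) b(1) nn by simp
  then have "(r * u - a * b)\<^sup>2 \<le> (cmod (herm z w))\<^sup>2" by (rule power_mono[OF le])
  moreover have "(r * u - a * b)\<^sup>2 - (a\<^sup>2 - r\<^sup>2) * (b\<^sup>2 - u\<^sup>2) = (r * b - a * u)\<^sup>2"
    by (simp add: power2_eq_square algebra_simps)
  moreover have "(r * b - a * u)\<^sup>2 \<ge> 0" by simp
  ultimately have "(a\<^sup>2 - r\<^sup>2) * (b\<^sup>2 - u\<^sup>2) \<le> (cmod (herm z w))\<^sup>2" by linarith
  then show ?thesis by (simp only: zz ww a b)
qed

lemma bergman_cosh:
  assumes z: "Re (herm z z) < 0" and w: "Re (herm w w) < 0"
  shows "0 \<le> bergman (cline z) (cline w)"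
    and "complex_of_real ((cosh (bergman (cline z) (cline w) / 2))\<^sup>2)
           = herm z w * herm w z / (herm z z * herm w w)"
proof -
  define k where "k = (cmod (herm z w))\<^sup>2 / (Re (herm z z) * Re (herm w w))"
  have k1: "k \<ge> 1"
    using reverse_cauchy_schwarz[OF z w] z w by (simp add: k_def mult_neg_neg)
  have real: "herm x x = of_real (Re (herm x x))" for x
    by (simp add: complex_eq_iff herm_def)
  have k: "complex_of_real k = herm z w * herm w z / (herm z z * herm w w)"
    using real[of z] real[of w] complex_norm_square[of "herm z w"]
    by (simp add: k_def herm_cnj)
  have zw: "herm z z \<noteq> 0" "herm w w \<noteq> 0" using z w by auto
  have scale: "herm x y * herm y x / (herm x x * herm y y) = complex_of_real k"
    if "x \<in> cline z - {0}" "y \<in> cline w - {0}" for x y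
  proof -
    obtain a b where "x = a *s z" "y = b *s w" "a \<noteq> 0" "b \<noteq> 0"
      using \<open>x \<in> cline z - {0}\<close> \<open>y \<in> cline w - {0}\<close> by (auto simp: vec.span_singleton)
    then show ?thesis unfolding k using zw by (simp add: herm_scale_left herm_scale_right)
  qed
  have z0: "z \<in> cline z - {0}" and w0: "w \<in> cline w - {0}"
    using z w by (auto simp: vec.span_base herm_def)
  have char: "(\<forall>x \<in> cline z - {0}. \<forall>y \<in> cline w - {0}.
      complex_of_real ((cosh (r / 2))\<^sup>2) = herm x y * herm y x / (herm x x * herm y y))
      \<longleftrightarrow> (cosh (r / 2))\<^sup>2 = k" for r
    using scale z0 w0 by (metis of_real_eq_iff)
  define r0 where "r0 = 2 * arcosh (sqrt k)"
  have r0: "0 \<le> r0" "(cosh (r0 / 2))\<^sup>2 = k"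
    using k1 by (simp_all add: r0_def)
  have uniq: "r = r0" if "0 \<le> r \<and> (cosh (r / 2))\<^sup>2 = k" for r
  proof -
    have "cosh (r / 2) = sqrt k" using that by (metis cosh_real_nonneg real_sqrt_unique)
    then show ?thesis using that arcosh_cosh_real[of "r / 2"] by (simp add: r0_def)
  qed
  have "bergman (cline z) (cline w) = r0"
    unfolding bergman_def char by (rule the_equality) (use r0 uniq in blast)+
  then show "0 \<le> bergman (cline z) (cline w)"
    and "complex_of_real ((cosh (bergman (cline z) (cline w) / 2))\<^sup>2)
           = herm z w * herm w z / (herm z z * herm w w)"
    using r0 k by simp_all
qed

lemma mat_vector_mul: "(mat a :: complex^3^3) *v z = a *s z"
  by (simp add: vec_eq_iff matrix_vector_mult_def mat_def sum_3 forall_3)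

lemma herm_nondegenerate:
  assumes "\<And>w. herm z w = 0"
  shows "z = 0"
  using assms[of "axis 1 1"] assms[of "axis 2 1"] assms[of "axis 3 1"]
  by (simp add: vec_eq_iff herm_def axis_def forall_3)

lemma group_U21: "group U21"
proof (rule groupI)
  fix A assume A: "A \<in> carrier U21"
  have "inj ((*v) A)"
  proof (rule injI)
    fix x y assume "A *v x = A *v y"
    then have "A *v (x - y) = 0" by (simp add: matrix_vector_mult_diff_distrib)
    moreover have "herm (A *v (x - y)) (A *v w) = herm (x - y) w" for w
      using A by (simp add: U21_def)
    ultimately have "herm (x - y) w = 0" for w by (metis herm_zero_left)
    then show "x = y" using herm_nondegenerate by fastforce
  qed
  then obtain B where B: "B ** A = mat 1"
    using matrix_left_invertible_injective by blast
  then have AB: "A ** B = mat 1" using matrix_left_right_inverse by blast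
  have "herm (B *v z) (B *v w) = herm (A *v (B *v z)) (A *v (B *v w))" for z w
    using A by (simp add: U21_def)
  then have "B \<in> carrier U21"
    by (simp add: U21_def matrix_vector_mul_assoc AB)
  with B show "\<exists>y\<in>carrier U21. y \<otimes>\<^bsub>U21\<^esub> A = \<one>\<^bsub>U21\<^esub>"
    by (auto simp: U21_def)
qed (simp_all add: U21_def matrix_mul_assoc flip: matrix_vector_mul_assoc)

lemma U21_scalars_subset: "U21_scalars \<subseteq> carrier U21"
proof
  fix A assume "A \<in> U21_scalars"
  then obtain a where a: "A = mat a" "cmod a = 1" by (auto simp: U21_scalars_def)
  have "cnj a * a = 1" using a(2) by (simp add: mult.commute flip: complex_norm_square)
  then have "herm (a *s z) (a *s w) = herm z w" for z w
    by (simp add: herm_scale_left herm_scale_right flip: mult.assoc)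
  then show "A \<in> carrier U21" by (simp add: a U21_def mat_vector_mul)
qed

lemma mat_mult_mat: "(mat a :: complex^3^3) ** mat b = mat (a * b)"
  by (simp add: matrix_eq mat_vector_mul flip: matrix_vector_mul_assoc)

lemma mat_commute: "(A :: complex^3^3) ** mat b = mat b ** A"
  by (simp add: matrix_eq mat_vector_mul vector_scalar_commute flip: matrix_vector_mul_assoc)

lemma normal_U21_scalars: "U21_scalars \<lhd> U21"
proof -
  interpret group U21 by (rule group_U21)
  have sub: "subgroup U21_scalars U21"
  proof (rule subgroupI)
    fix A assume A: "A \<in> U21_scalars"
    then obtain a where a: "A = mat a" "cmod a = 1" by (auto simp: U21_scalars_def)
    have B: "mat (inverse a) \<in> U21_scalars"
      using a by (auto simp: U21_scalars_def norm_inverse)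
    have "mat (inverse a) \<otimes>\<^bsub>U21\<^esub> A = \<one>\<^bsub>U21\<^esub>"
      using a(2) by (cases "a = 0") (simp_all add: a(1) U21_def mat_mult_mat)
    then have "inv\<^bsub>U21\<^esub> A = mat (inverse a)"
      using A B U21_scalars_subset by (intro inv_equality) auto
    with B show "inv\<^bsub>U21\<^esub> A \<in> U21_scalars" by simp
  next
    fix A B assume "A \<in> U21_scalars" "B \<in> U21_scalars"
    then obtain a b where "A = mat a" "B = mat b" "cmod a = 1" "cmod b = 1"
      by (auto simp: U21_scalars_def)
    then show "A \<otimes>\<^bsub>U21\<^esub> B \<in> U21_scalars"
      by (auto simp: U21_def U21_scalars_def mat_mult_mat norm_mult)
  qed (use U21_scalars_subset in \<open>auto simp: U21_scalars_def intro: exI[of _ 1]\<close>)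
  show ?thesis
    by (rule normalI[OF sub])
      (auto simp: r_coset_def l_coset_def U21_def U21_scalars_def mat_commute)
qed

lemma group_PU21: "group PU21"
  unfolding PU21_def by (rule normal.factorgroup_is_group[OF normal_U21_scalars])

lemma carrier_PU21: "carrier PU21 = PU21_class ` carrier U21"
  by (simp add: PU21_def PU21_class_def carrier_FactGroup)

lemma openin_PU21_topology:
  "openin PU21_topology S \<longleftrightarrow> S \<subseteq> carrier PU21 \<and>
     openin (top_of_set (carrier U21)) {A \<in> carrier U21. PU21_class A \<in> S}"
proof -
  let ?P = "\<lambda>S. {A \<in> carrier U21. PU21_class A \<in> S}"
  have "istopology (\<lambda>S. S \<subseteq> carrier PU21 \<and> openin (top_of_set (carrier U21)) (?P S))"
    unfolding istopology_def
  proof (intro conjI allI impI)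
    fix S T
    assume "S \<subseteq> carrier PU21 \<and> openin (top_of_set (carrier U21)) (?P S)"
      and "T \<subseteq> carrier PU21 \<and> openin (top_of_set (carrier U21)) (?P T)"
    moreover have "?P (S \<inter> T) = ?P S \<inter> ?P T" by auto
    ultimately show "S \<inter> T \<subseteq> carrier PU21" "openin (top_of_set (carrier U21)) (?P (S \<inter> T))"
      by (auto intro: openin_Int)
  next
    fix \<K> assume K: "\<forall>K\<in>\<K>. K \<subseteq> carrier PU21 \<and> openin (top_of_set (carrier U21)) (?P K)"
    have "?P (\<Union>\<K>) = \<Union> (?P ` \<K>)" by auto
    then show "openin (top_of_set (carrier U21)) (?P (\<Union>\<K>))"
      using K by (auto intro!: openin_Union simp del: UN_simps)
    show "\<Union>\<K> \<subseteq> carrier PU21" using K by blast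
  qed
  then show ?thesis by (simp add: PU21_topology_def)
qed

lemma topspace_PU21_topology: "topspace PU21_topology = carrier PU21"
proof -
  have "{A \<in> carrier U21. PU21_class A \<in> carrier PU21} = carrier U21"
    by (auto simp: carrier_PU21)
  then have "openin PU21_topology (carrier PU21)"
    by (simp add: openin_PU21_topology)
  then show ?thesis
    using openin_PU21_topology[of "topspace PU21_topology"] openin_subset by blast
qed

lemma quotient_map_PU21_class: "quotient_map (top_of_set (carrier U21)) PU21_topology PU21_class"
  by (simp add: quotient_map_def topspace_PU21_topology openin_PU21_topology carrier_PU21)

lemma matrix_reflection_map: "matrix (reflection_map n c) *v z = reflection_map n c z"
proof -
  define k where "k = (1 - exp (2 * of_real pi * \<i> / of_nat n :: complex)) / herm c c"
  have k: "reflection_map n c = (\<lambda>z. - z + (k * herm z c) *s c)"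
    by (simp add: fun_eq_iff reflection_map_def k_def)
  have "Vector_Spaces.linear (*s) (*s) (reflection_map n c)"
    unfolding k by unfold_locales
      (simp_all add: vec_eq_iff herm_add_left herm_scale_left algebra_simps)
  then show ?thesis by (rule matrix_works)
qed

lemma reflection_in_U21:
  assumes "herm c c \<noteq> 0"
  shows "matrix (reflection_map n c) \<in> carrier U21"
proof -
  define \<mu> where "\<mu> = exp (2 * of_real pi * \<i> / of_nat n :: complex)"
  have "\<mu> = cis (2 * pi / n)" by (simp add: \<mu>_def cis_conv_exp mult_ac)
  then have mu: "\<mu> * cnj \<mu> = 1" by (simp add: cis_cnj cis_mult)
  have "herm (reflection_map n c z) (reflection_map n c w) = herm z w" for z w
  proof -
    have alg: "h - B * (y / N) * x - A * (x / N) * y + A * (x / N) * (B * (y / N)) * N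
        = h + x * y / N * (A * B - A - B)" if "N = herm c c" for h x y A B N :: complex
      using assms that by (simp add: field_simps)
    have expand: "herm (- z + a *s c) (- w + b *s c)
        = herm z w - cnj b * herm z c - a * herm c w + a * cnj b * herm c c" for a b
      by (simp add: herm_def algebra_simps)
    have "herm (reflection_map n c z) (reflection_map n c w)
        = herm z w + herm z c * herm c w / herm c c *
            ((1 - \<mu>) * (1 - cnj \<mu>) - (1 - \<mu>) - (1 - cnj \<mu>))"
      unfolding reflection_map_def \<mu>_def[symmetric] expand complex_cnj_mult
        complex_cnj_divide complex_cnj_diff complex_cnj_one herm_cnj
      by (rule alg[OF refl])
    also have "(1 - \<mu>) * (1 - cnj \<mu>) - (1 - \<mu>) - (1 - cnj \<mu>) = 0"
      using mu by (simp add: algebra_simps)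
    finally show ?thesis by simp
  qed
  then show ?thesis by (simp add: U21_def matrix_reflection_map)
qed

lemma minimal_reflection_in_PU21:
  "herm c c \<noteq> 0 \<Longrightarrow> minimal_reflection n c \<in> carrier PU21"
  unfolding minimal_reflection_def carrier_PU21 by (intro imageI reflection_in_U21)

end

theory Submission
  imports Defs
begin

text \<open>Let \<open>r = cosh (m/2)\<close>. The polar vectors satisfy \<open>\<bar>\<langle>c\<^sub>3,c\<^sub>2\<rangle>\<bar> = \<bar>\<langle>c\<^sub>1,c\<^sub>3\<rangle>\<bar> = r\<close> and
  \<open>\<bar>\<langle>c\<^sub>2,c\<^sub>1\<rangle>\<bar> = 1\<close>; this is \<open>cosh_half_dist_of_pair\<close>. After \<open>c\<^sub>1\<close> is multiplied by a unit scalar,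
  \<open>\<langle>c\<^sub>2,c\<^sub>1\<rangle> = 1\<close>, and \<open>p = c\<^sub>1 - c\<^sub>2\<close> is a null vector orthogonal to \<open>c\<^sub>1\<close> and \<open>c\<^sub>2\<close>. It represents the point
  of the boundary where the first two geodesics meet.

  The cube \<open>T\<close> of the product of the reflections \<open>\<iota>\<^sub>1\<close> and \<open>\<iota>\<^sub>2\<close> is the vertical Heisenberg
  translation \<open>z \<mapsto> z + 3 \<surd>3 \<i> \<langle>z,p\<rangle> p\<close>; this is \<open>reflection_product_cube\<close>. A discrete group that
  contains such a translation obeys Shimizu's inequality: an element \<open>A\<close> of it that does not fix
  \<open>[p]\<close> satisfies \<open>3 \<surd>3 \<bar>\<langle>p,A p\<rangle>\<bar> \<ge> 1\<close>. Otherwise the sequence \<open>B\<^sub>0 = A\<close>,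
  \<open>B\<^sub>n\<^sub>+\<^sub>1 = B\<^sub>n T B\<^sub>n\<^sup>-\<^sup>1\<close> would accumulate at \<open>T\<close>; this is \<open>shimizu_transvection\<close>. All \<open>B\<^sub>n\<close> with
  \<open>n > 0\<close> are transvections along the vectors \<open>B\<^sub>n\<^sub>-\<^sub>1 p\<close>, so only the behaviour of one vector in a plane
  has to be followed.

  For \<open>A = \<iota>\<^sub>3\<close>, of order two, \<open>\<bar>\<langle>p,A p\<rangle>\<bar> = 2 \<bar>\<langle>p,c\<^sub>3\<rangle>\<bar>\<^sup>2\<close>, and expanding
  \<open>\<langle>p,c\<^sub>3\<rangle> = \<langle>c\<^sub>1,c\<^sub>3\<rangle> - \<langle>c\<^sub>2,c\<^sub>3\<rangle>\<close> gives \<open>\<bar>\<langle>p,c\<^sub>3\<rangle>\<bar>\<^sup>2 = 2 r\<^sup>2 (1 - cos \<alpha>)\<close>. The hypothesis on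
  \<open>\<alpha>\<close> says exactly that \<open>3 \<surd>3 \<cdot> 4 r\<^sup>2 (1 - cos \<alpha>) < 1\<close>, and \<open>0 < \<alpha> < 2 \<pi>\<close> makes this quantity
  positive.\<close>


section \<open>The Hermitian form\<close>

lemma herm_diff_left: "herm (x - y) z = herm x z - herm y z"
  and herm_diff_right: "herm z (x - y) = herm z x - herm z y"
  by (simp_all add: herm_def algebra_simps)

lemma herm_self_real: "herm z z = of_real (Re (herm z z))"
  by (simp add: complex_eq_iff herm_def)

lemma herm_mult_swap: "herm z w * herm w z = of_real ((cmod (herm z w))\<^sup>2)"
  using complex_norm_square[of "herm z w"] by (simp add: herm_cnj)

lemma cmod_herm_commute: "cmod (herm z w) = cmod (herm w z)"
  by (metis complex_mod_cnj herm_cnj)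

lemma herm_zero_commute: "herm z w = 0 \<longleftrightarrow> herm w z = 0"
  by (metis complex_cnj_zero herm_cnj)

lemma herm_project_orthogonal:
  assumes "herm c c = 1"
  shows "herm (x - herm x c *s c) c = 0"
  using assms by (simp add: herm_diff_left herm_scale_left)

lemma herm_project_self:
  assumes "herm c c = 1"
  shows "Re (herm (x - herm x c *s c) (x - herm x c *s c)) = Re (herm x x) - (cmod (herm x c))\<^sup>2"
proof -
  have "herm (x - herm x c *s c) (x - herm x c *s c) = herm x x - herm x c * herm c x"
    using assms by (simp add: herm_diff_left herm_diff_right herm_scale_left herm_scale_right herm_cnj)
  then show ?thesis by (simp add: herm_mult_swap)
qed

section \<open>Common points of two complex geodesics\<close>

text \<open>The Hermitian cross product. It is the cross product of \<open>c\<close> and \<open>d\<close>, conjugated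
  and with its last entry negated, so that vanishing of \<open>herm\<close> replaces vanishing of the bilinear
  dot product.\<close>
definition polar_cross :: "complex^3 \<Rightarrow> complex^3 \<Rightarrow> complex^3" where
  "polar_cross c d = vector [cnj (c $ 2 * d $ 3 - c $ 3 * d $ 2),
                             cnj (c $ 3 * d $ 1 - c $ 1 * d $ 3),
                             - cnj (c $ 1 * d $ 2 - c $ 2 * d $ 1)]"

lemma polar_cross_orthogonal:
  "herm c (polar_cross c d) = 0" "herm d (polar_cross c d) = 0"
  by (simp_all add: polar_cross_def herm_def algebra_simps)

text \<open>Lagrange's identity for the indefinite form. For normalised polar vectors the right side is
  \<open>\<bar>\<langle>c,d\<rangle>\<bar>\<^sup>2 - 1\<close>, so the position of the common point of two complex geodesics, inside, on or
  outside the boundary, is read off from \<open>\<bar>\<langle>c,d\<rangle>\<bar>\<close>.\<close>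
lemma herm_polar_cross_self:
  "herm (polar_cross c d) (polar_cross c d) = herm c d * herm d c - herm c c * herm d d"
  by (simp add: polar_cross_def herm_def algebra_simps)

text \<open>Two distinct projective lines meet in only one point: conjugation turns the two
  orthogonality conditions into linear equations, and \<open>u \<times> (c \<times> d) = c (u \<cdot> d) - d (u \<cdot> c)\<close>
  vanishes on their solutions.\<close>
lemma orthogonal_imp_multiple_of_polar_cross:
  assumes "herm c v = 0" and "herm d v = 0" and "polar_cross c d \<noteq> 0"
  shows "\<exists>a. v = a *s polar_cross c d"
proof -
  define z where "z = polar_cross c d"
  have swap: "v $ i * z $ j = v $ j * z $ i" for i j
  proof -
    have c: "cnj (herm c v) = 0" and d: "cnj (herm d v) = 0" using assms by simp_all
    have "v $ 1 * z $ 2 = v $ 2 * z $ 1" "v $ 1 * z $ 3 = v $ 3 * z $ 1" "v $ 2 * z $ 3 = v $ 3 * z $ 2"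
      using c d unfolding z_def by (simp_all add: polar_cross_def herm_def) (algebra+)
    then show ?thesis
      using exhaust_3[of i] exhaust_3[of j] by auto
  qed
  obtain j where j: "z $ j \<noteq> 0" using assms(3) by (auto simp: z_def vec_eq_iff)
  have "v = (v $ j / z $ j) *s z"
    using j swap by (simp add: vec_eq_iff field_simps)
  then show ?thesis by (auto simp: z_def)
qed

lemma cline_in_polar_line:
  assumes "z \<noteq> 0"
  shows "cline z \<in> polar_line c \<longleftrightarrow> herm c z = 0"
proof
  assume "cline z \<in> polar_line c"
  then obtain w where w: "cline z = cline w" "herm c w = 0" by (auto simp: polar_line_def)
  have "z \<in> cline w" using w(1) vec.span_base[of z "{z}"] by simp
  then show "herm c z = 0" using w(2) by (auto simp: vec.span_singleton herm_scale_right)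
qed (use assms in \<open>auto simp: polar_line_def\<close>)

lemma negative_nonzero: "Re (herm z z) < 0 \<Longrightarrow> z \<noteq> 0"
  by (auto simp: herm_zero_left)

lemma in_polar_line_hyp_plane:
  "p \<in> polar_line c \<inter> hyp_plane \<longleftrightarrow> (\<exists>z. p = cline z \<and> Re (herm z z) < 0 \<and> herm z c = 0)"
  by (auto simp: hyp_plane_def cline_in_polar_line negative_nonzero herm_zero_commute[of c])

text \<open>The projection of the negative basis vector to the orthogonal complement of \<open>c\<close> serves as
  a base point of the complex geodesic. It has the further property of not being orthogonal to any
  null vector of that geodesic, because a null vector with vanishing last entry is zero.\<close>
lemma ex_negative_orthogonal:
  assumes "herm c c = 1"
  obtains x where "Re (herm x x) < 0" "herm x c = 0"
    "\<And>p. herm p c = 0 \<Longrightarrow> herm p p = 0 \<Longrightarrow> p \<noteq> 0 \<Longrightarrow> herm p x \<noteq> 0"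
proof -
  define e where "e = (axis 3 1 :: complex^3)"
  define x where "x = e - herm e c *s c"
  have ee: "herm e e = -1" by (simp add: e_def herm_def axis_def)
  have "Re (herm x x) = - 1 - (cmod (herm e c))\<^sup>2"
    unfolding x_def herm_project_self[OF assms] by (simp add: ee)
  then have "Re (herm x x) < 0" using zero_le_power2[of "cmod (herm e c)"] by linarith
  moreover have "herm x c = 0" unfolding x_def by (rule herm_project_orthogonal[OF assms])
  moreover have "herm p x \<noteq> 0" if "herm p c = 0" "herm p p = 0" "p \<noteq> 0" for p
  proof
    assume "herm p x = 0"
    then have "p $ 3 = 0"
      using that(1) by (simp add: x_def herm_diff_right herm_scale_right e_def)
        (simp add: herm_def axis_def)
    moreover from this have "complex_of_real ((cmod (p $ 1))\<^sup>2 + (cmod (p $ 2))\<^sup>2) = 0"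
      using that(2) unfolding herm_def of_real_add complex_norm_square by simp
    then have "p $ 1 = 0 \<and> p $ 2 = 0"
      unfolding of_real_eq_0_iff by (simp add: sum_power2_eq_zero_iff)
    ultimately have "p = 0" by (simp add: vec_eq_iff forall_3)
    with that(3) show False ..
  qed
  ultimately show thesis by (rule that)
qed

text \<open>If \<open>\<bar>\<langle>c,d\<rangle>\<bar> \<le> 1\<close>, the vector \<open>polar_cross c d\<close> is not positive, so unless it vanishes
  it represents a common point in the closure of the hyperbolic plane. If it vanishes, the two
  geodesics coincide and any point of them is a common one.\<close>
lemma ultra_parallel_imp:
  assumes c: "herm c c = 1" and d: "herm d d = 1"
    and up: "ultra_parallel (polar_line c) (polar_line d)"
  shows "cmod (herm c d) > 1"
proof (rule ccontr)
  assume "\<not> ?thesis"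
  then have le: "(cmod (herm c d))\<^sup>2 \<le> 1" by (simp add: power_le_one)
  define z where "z = polar_cross c d"
  have zz: "herm z z = of_real ((cmod (herm c d))\<^sup>2 - 1)"
    by (simp add: z_def herm_polar_cross_self c d herm_mult_swap)
  show False
  proof (cases "z = 0")
    case True
    then have "(cmod (herm c d))\<^sup>2 = 1"
      using zz unfolding True herm_zero_left by (metis eq_iff_diff_eq_0 of_real_eq_0_iff)
    obtain x where x: "Re (herm x x) < 0" "herm x c = 0"
      using ex_negative_orthogonal[OF c] by blast
    have "herm d x = 0"
    proof -
      have "c \<noteq> 0" using c by (auto simp: herm_zero_left)
      have "c $ 2 * d $ 3 - c $ 3 * d $ 2 = cnj (z $ 1)"
        "c $ 3 * d $ 1 - c $ 1 * d $ 3 = cnj (z $ 2)"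
        "c $ 1 * d $ 2 - c $ 2 * d $ 1 = - cnj (z $ 3)"
        by (simp_all add: z_def polar_cross_def)
      then have "c $ i * d $ j = c $ j * d $ i" for i j
        using True exhaust_3[of i] exhaust_3[of j] by auto
      moreover obtain j where "c $ j \<noteq> 0" using \<open>c \<noteq> 0\<close> by (auto simp: vec_eq_iff)
      ultimately have "d = (d $ j / c $ j) *s c"
        by (simp add: vec_eq_iff field_simps)
      then show ?thesis using x(2) by (metis herm_scale_left herm_zero_commute mult_zero_right)
    qed
    then have "cline x \<in> polar_line c \<inter> polar_line d \<inter> (hyp_plane \<union> hyp_boundary)"
      using x negative_nonzero[OF x(1)]
      by (auto simp: cline_in_polar_line hyp_plane_def herm_zero_commute[of c])
    with up show False by (auto simp: ultra_parallel_def)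
  next
    case False
    have "cline z \<in> hyp_plane \<union> hyp_boundary"
    proof (cases "Re (herm z z) < 0")
      case True
      then show ?thesis by (auto simp: hyp_plane_def)
    next
      case nn: False
      then have "herm z z = 0" using le zz by simp
      with False show ?thesis by (auto simp: hyp_boundary_def)
    qed
    then have "cline z \<in> polar_line c \<inter> polar_line d \<inter> (hyp_plane \<union> hyp_boundary)"
      using False by (simp add: cline_in_polar_line z_def polar_cross_orthogonal)
    with up show False by (auto simp: ultra_parallel_def)
  qed
qed

text \<open>The null vector of a common boundary point is a multiple of \<open>polar_cross c d\<close>, which is
  therefore null as well.\<close>
lemma ideal_pair_imp:
  assumes c: "herm c c = 1" and d: "herm d d = 1"
    and ideal: "ideal_pair (polar_line c) (polar_line d)"
  shows "cmod (herm c d) = 1"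
proof -
  obtain v where v: "v \<noteq> 0" "herm v v = 0" "cline v \<in> polar_line c" "cline v \<in> polar_line d"
    using ideal by (auto simp: ideal_pair_def hyp_boundary_def)
  then have cv: "herm c v = 0" "herm d v = 0" by (simp_all add: cline_in_polar_line)
  define z where "z = polar_cross c d"
  have "herm z z = 0"
  proof (cases "z = 0")
    case False
    then obtain a where "v = a *s z"
      using orthogonal_imp_multiple_of_polar_cross[OF cv] by (auto simp: z_def)
    then show ?thesis using v(1,2) by (auto simp: herm_scale_left herm_scale_right)
  qed (simp add: herm_zero_left)
  then have "complex_of_real ((cmod (herm c d))\<^sup>2) = of_real 1"
    by (simp add: z_def herm_polar_cross_self c d herm_mult_swap)
  then have "(cmod (herm c d))\<^sup>2 = 1" by (simp only: of_real_eq_iff)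
  then show ?thesis using power2_eq_1_iff[of "cmod (herm c d)"] norm_ge_zero[of "herm c d"] by linarith
qed

lemma polar_line_scale: "a \<noteq> 0 \<Longrightarrow> polar_line (a *s c) = polar_line c"
  by (simp add: polar_line_def herm_scale_left)

section \<open>The distance of two complex geodesics\<close>

lemma bergman_cosh_norm:
  assumes z: "Re (herm z z) < 0" and w: "Re (herm w w) < 0"
  shows "(cosh (bergman (cline z) (cline w) / 2))\<^sup>2
           = (cmod (herm z w))\<^sup>2 / (Re (herm z z) * Re (herm w w))"
proof -
  have "complex_of_real ((cosh (bergman (cline z) (cline w) / 2))\<^sup>2)
      = of_real ((cmod (herm z w))\<^sup>2 / (Re (herm z z) * Re (herm w w)))"
    unfolding bergman_cosh(2)[OF z w] herm_mult_swap
    using herm_self_real[of z] herm_self_real[of w] by simp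
  then show ?thesis by (simp only: of_real_eq_iff)
qed

text \<open>Two applications of the reverse Cauchy-Schwarz inequality. Replacing \<open>y\<close> by its
  projection \<open>y'\<close> to the complement of \<open>c\<close> does not change \<open>\<langle>x,y\<rangle>\<close>, and costs
  \<open>\<bar>\<langle>y,c\<rangle>\<bar>\<^sup>2\<close> in the norm; this loss is bounded below by comparing \<open>y\<close> with the projection \<open>q\<close>
  of \<open>c\<close> to the complement of \<open>d\<close>, whose norm is \<open>1 - \<bar>\<langle>c,d\<rangle>\<bar>\<^sup>2 \<le> 0\<close>.\<close>
lemma cosh_bergman_ge:
  assumes c: "herm c c = 1" and d: "herm d d = 1" and ge: "cmod (herm c d) \<ge> 1"
    and x: "Re (herm x x) < 0" "herm x c = 0" and y: "Re (herm y y) < 0" "herm y d = 0"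
  shows "(cmod (herm c d))\<^sup>2 \<le> (cosh (bergman (cline x) (cline y) / 2))\<^sup>2"
proof -
  define r where "r = cmod (herm c d)"
  define q where "q = c - herm c d *s d"
  define y' where "y' = y - herm y c *s c"
  have qq: "Re (herm q q) = 1 - r\<^sup>2"
    unfolding q_def herm_project_self[OF d] by (simp add: c r_def)
  have yq: "herm y c = herm y q"
    using y(2) by (simp add: q_def herm_diff_right herm_scale_right)
  have "r\<^sup>2 \<ge> 1" using ge by (simp add: r_def)
  have step1: "Re (herm y y) * (1 - r\<^sup>2) \<le> (cmod (herm y c))\<^sup>2"
  proof (cases "r\<^sup>2 = 1")
    case False
    then have "Re (herm q q) < 0" using qq \<open>r\<^sup>2 \<ge> 1\<close> by simp
    then show ?thesis using reverse_cauchy_schwarz[OF y(1), of q] by (simp add: qq yq)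
  qed simp
  have y'y': "Re (herm y' y') = Re (herm y y) - (cmod (herm y c))\<^sup>2"
    unfolding y'_def by (rule herm_project_self[OF c])
  then have "Re (herm y' y') < 0" using y(1) zero_le_power2[of "cmod (herm y c)"] by linarith
  moreover have "herm x y' = herm x y"
    using x(2) by (simp add: y'_def herm_diff_right herm_scale_right)
  ultimately have "Re (herm x x) * Re (herm y' y') \<le> (cmod (herm x y))\<^sup>2"
    using reverse_cauchy_schwarz[OF x(1), of y'] by simp
  moreover have "Re (herm x x) * (r\<^sup>2 * Re (herm y y)) \<le> Re (herm x x) * Re (herm y' y')"
    using x(1) step1 y'y' by (intro mult_left_mono_neg) (simp_all add: algebra_simps)
  ultimately have "r\<^sup>2 * (Re (herm x x) * Re (herm y y)) \<le> (cmod (herm x y))\<^sup>2"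
    by (simp add: mult_ac)
  then show ?thesis
    unfolding bergman_cosh_norm[OF x(1) y(1)] r_def[symmetric]
    using x(1) y(1) by (simp add: pos_le_divide_eq mult_neg_neg)
qed

text \<open>The orthogonal projection of a point to the complex geodesic polar to \<open>d\<close> supplies the
  pairs of points that bound the distance of two geodesics from above.\<close>
lemma cosh_bergman_projection:
  assumes d: "herm d d = 1" and x: "Re (herm x x) < 0"
  defines "y \<equiv> x - herm x d *s d"
  shows "Re (herm y y) < 0"
    and "(cosh (bergman (cline x) (cline y) / 2))\<^sup>2 = 1 - (cmod (herm x d))\<^sup>2 / Re (herm x x)"
proof -
  have yy: "Re (herm y y) = Re (herm x x) - (cmod (herm x d))\<^sup>2"
    unfolding y_def by (rule herm_project_self[OF d])
  then show neg: "Re (herm y y) < 0" using x zero_le_power2[of "cmod (herm x d)"] by linarith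
  have "herm y d = 0" unfolding y_def by (rule herm_project_orthogonal[OF d])
  then have "herm y x = herm y y"
    by (simp add: y_def herm_diff_right herm_scale_right)
  then have "cmod (herm x y) = cmod (of_real (Re (herm y y)))"
    by (metis cmod_herm_commute herm_self_real)
  then have "(cmod (herm x y))\<^sup>2 = (Re (herm y y))\<^sup>2" by simp
  then show "(cosh (bergman (cline x) (cline y) / 2))\<^sup>2 = 1 - (cmod (herm x d))\<^sup>2 / Re (herm x x)"
    unfolding bergman_cosh_norm[OF x neg] using x neg
    by (simp add: yy power2_eq_square[of "Re (herm x x) - (cmod (herm x d))\<^sup>2"] diff_divide_distrib)
qed

text \<open>The lower bound is \<open>cosh_bergman_ge\<close>. For \<open>\<bar>\<langle>c,d\<rangle>\<bar> > 1\<close> it is attained at the foot \<open>p\<close> of the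
  common perpendicular, the projection of \<open>d\<close> to the complement of \<open>c\<close>. For
  \<open>\<bar>\<langle>c,d\<rangle>\<bar> = 1\<close> that vector \<open>p\<close> is null and represents the common boundary point; the
  infimum is approached, but not attained, along points of the first geodesic that tend to it.\<close>
lemma cosh_half_geodesic_dist:
  assumes c: "herm c c = 1" and d: "herm d d = 1" and ge: "cmod (herm c d) \<ge> 1"
    and ne: "polar_line c \<noteq> polar_line d"
  shows "cosh (geodesic_dist (polar_line c) (polar_line d) / 2) = cmod (herm c d)"
proof -
  define r where "r = cmod (herm c d)"
  define D where "D = {bergman p q | p q. p \<in> polar_line c \<inter> hyp_plane \<and> q \<in> polar_line d \<inter> hyp_plane}"
  have r1: "r \<ge> 1" using ge by (simp add: r_def)
  have D_iff: "b \<in> D \<longleftrightarrow> (\<exists>x y. b = bergman (cline x) (cline y) \<and>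
      Re (herm x x) < 0 \<and> herm x c = 0 \<and> Re (herm y y) < 0 \<and> herm y d = 0)" for b
    unfolding D_def in_polar_line_hyp_plane by blast
  have lower: "0 \<le> b \<and> r \<le> cosh (b / 2)" if "b \<in> D" for b
  proof -
    obtain x y where b: "b = bergman (cline x) (cline y)" and xy:
      "Re (herm x x) < 0" "herm x c = 0" "Re (herm y y) < 0" "herm y d = 0"
      using \<open>b \<in> D\<close> unfolding D_iff by blast
    have "r\<^sup>2 \<le> (cosh (b / 2))\<^sup>2"
      unfolding b r_def by (rule cosh_bergman_ge[OF c d ge xy])
    then have "r \<le> cosh (b / 2)" by (rule power2_le_imp_le) simp
    then show ?thesis using bergman_cosh(1)[OF xy(1,3)] b by simp
  qed
  have proj: "\<exists>b\<in>D. (cosh (b / 2))\<^sup>2 = 1 - (cmod (herm x d))\<^sup>2 / Re (herm x x)"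
    if "Re (herm x x) < 0" "herm x c = 0" for x
    using that cosh_bergman_projection[OF d that(1)] herm_project_orthogonal[OF d, of x]
    unfolding Bex_def D_iff by blast
  define p where "p = d - herm d c *s c"
  have pc: "herm p c = 0" unfolding p_def by (rule herm_project_orthogonal[OF c])
  have pp: "Re (herm p p) = 1 - r\<^sup>2"
    unfolding p_def herm_project_self[OF c] by (simp add: d r_def cmod_herm_commute)
  have pd: "herm p d = of_real (1 - r\<^sup>2)"
    by (simp add: p_def herm_diff_left herm_scale_left d herm_mult_swap r_def cmod_herm_commute)
  have upper: "\<exists>b\<in>D. (cosh (b / 2))\<^sup>2 < r\<^sup>2 + e" if "e > 0" for e
  proof (cases "r = 1")
    case False
    then have neg: "1 - r\<^sup>2 < 0" using r1 by (simp add: one_less_power)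
    then obtain b where "b \<in> D" "(cosh (b / 2))\<^sup>2 = 1 - (cmod (herm p d))\<^sup>2 / Re (herm p p)"
      using proj[of p] pc pp by auto
    moreover have "1 - (cmod (herm p d))\<^sup>2 / Re (herm p p) = r\<^sup>2"
      unfolding pd pp norm_of_real power2_abs using neg
      by (simp add: power2_eq_square[of "1 - r\<^sup>2"] del: minus_diff_eq)
    ultimately show ?thesis using that by force
  next
    case True
    have "p \<noteq> 0"
    proof
      assume "p = 0"
      then have "polar_line d = polar_line (herm d c *s c)" by (simp add: p_def)
      moreover have "herm d c \<noteq> 0" using True cmod_herm_commute[of c d] by (auto simp: r_def)
      ultimately show False using ne by (simp add: polar_line_scale)
    qed
    have p0: "herm p p = 0" using herm_self_real[of p] pp True by simp
    obtain x where x: "Re (herm x x) < 0" "herm x c = 0" and px: "herm p x \<noteq> 0"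
      using ex_negative_orthogonal[OF c] pc p0 \<open>p \<noteq> 0\<close> by metis
    define N where "N = (cmod (herm p x))\<^sup>2"
    define K where "K = (cmod (herm x d))\<^sup>2"
    have N: "N > 0" using px by (simp add: N_def)
    have K: "K \<ge> 0" by (simp add: K_def)
    \<comment> \<open>Moving by \<open>k\<close> towards \<open>p\<close> makes the norm of \<open>y\<close> at most \<open>- 2 * k * N\<close> and keeps \<open>\<langle>y,d\<rangle>\<close>;
      this \<open>k\<close> is large enough for \<open>K / (2 * k * N) < e\<close>.\<close>
    define k where "k = (K + 1) / (e * N)"
    have k: "k > 0" using N K that by (simp add: k_def)
    define y where "y = x - (of_real k * herm x p) *s p"
    have "herm y y = herm x x - 2 * of_real k * (herm p x * herm x p)"
      by (simp add: y_def herm_diff_left herm_diff_right herm_scale_left herm_scale_right p0 herm_cnj)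
    then have yy: "Re (herm y y) = Re (herm x x) - 2 * k * N"
      by (simp add: herm_mult_swap N_def)
    have kN: "k * N > 0" using k N by simp
    then have y: "Re (herm y y) < 0" using yy x(1) by linarith
    have yc: "herm y c = 0" by (simp add: y_def herm_diff_left herm_scale_left x(2) pc)
    have yd: "herm y d = herm x d"
      by (simp add: y_def herm_diff_left herm_scale_left pd True)
    obtain b where b: "b \<in> D" "(cosh (b / 2))\<^sup>2 = 1 - K / Re (herm y y)"
      using proj[OF y yc] by (auto simp: yd K_def)
    have "e * (k * N) = K + 1" using N that by (simp add: k_def)
    then have "K < e * (2 * (k * N) - Re (herm x x))"
      using K that x(1) mult_pos_neg[OF that x(1)] by (simp add: algebra_simps)
    then have "- K / Re (herm y y) < e"
      using y by (simp add: yy field_simps)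
    then show ?thesis using b True by force
  qed
  have Dne: "D \<noteq> {}" using upper[of 1] by auto
  have bdd: "bdd_below D" using lower by (auto intro: bdd_belowI[of _ 0])
  define m where "m = Inf D"
  have m0: "m \<ge> 0" unfolding m_def using Dne lower by (intro cInf_greatest) auto
  have "2 * arcosh r \<le> m"
    unfolding m_def
  proof (rule cInf_greatest[OF Dne])
    fix b assume b: "b \<in> D"
    then have "cosh (arcosh r) \<le> cosh (b / 2)" using lower r1 by simp
    then have "arcosh r \<le> b / 2"
      using lower[OF b] r1 by (subst (asm) cosh_real_nonneg_le_iff) auto
    then show "2 * arcosh r \<le> b" by simp
  qed
  then have "cosh (arcosh r) \<le> cosh (m / 2)"
    using r1 m0 by (subst cosh_real_nonneg_le_iff) auto
  then have ge: "r \<le> cosh (m / 2)" using r1 by simp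
  have "(cosh (m / 2))\<^sup>2 \<le> r\<^sup>2"
  proof (rule field_le_epsilon)
    fix e :: real assume "e > 0"
    then obtain b where b: "b \<in> D" "(cosh (b / 2))\<^sup>2 < r\<^sup>2 + e" using upper by blast
    have "m \<le> b" unfolding m_def by (rule cInf_lower[OF b(1) bdd])
    then have "cosh (m / 2) \<le> cosh (b / 2)"
      using m0 by (subst cosh_real_nonneg_le_iff) auto
    then have "(cosh (m / 2))\<^sup>2 \<le> (cosh (b / 2))\<^sup>2" by (rule power_mono) simp
    with b(2) show "(cosh (m / 2))\<^sup>2 \<le> r\<^sup>2 + e" by linarith
  qed
  then have "cosh (m / 2) \<le> r" by (rule power2_le_imp_le) (use r1 in simp)
  with ge show ?thesis by (simp add: m_def D_def geodesic_dist_def r_def)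
qed

lemma cosh_half_dist_of_pair:
  assumes c: "herm c c = 1" and d: "herm d d = 1"
    and pair: "ultra_parallel (polar_line c) (polar_line d) \<or> ideal_pair (polar_line c) (polar_line d)"
  shows "cmod (herm c d) = cosh (geodesic_dist (polar_line c) (polar_line d) / 2)"
proof -
  have ge: "cmod (herm c d) \<ge> 1"
    using pair ultra_parallel_imp[OF c d] ideal_pair_imp[OF c d] by force
  have "polar_line c \<noteq> polar_line d"
  proof
    assume eq: "polar_line c = polar_line d"
    obtain x where "Re (herm x x) < 0" "herm x c = 0"
      using ex_negative_orthogonal[OF c] by blast
    then have "cline x \<in> polar_line c \<inter> hyp_plane" unfolding in_polar_line_hyp_plane by blast
    then show False using pair eq by (auto simp: ultra_parallel_def ideal_pair_def)
  qed
  then show ?thesis using cosh_half_geodesic_dist[OF c d ge] by simp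
qed

section \<open>Transvections and discreteness\<close>

text \<open>For a null vector \<open>p\<close> these are the vertical Heisenberg translations that fix the boundary
  point \<open>[p]\<close>.\<close>
definition transvection :: "real \<Rightarrow> complex^3 \<Rightarrow> complex^3^3" where
  "transvection s p = matrix (\<lambda>z. z + (\<i> * of_real s * herm z p) *s p)"

lemma transvection_apply: "transvection s p *v z = z + (\<i> * of_real s * herm z p) *s p"
proof -
  have "Vector_Spaces.linear (*s) (*s) (\<lambda>z. z + (\<i> * of_real s * herm z p) *s p)"
    by unfold_locales (simp_all add: vec_eq_iff herm_add_left herm_scale_left algebra_simps)
  then show ?thesis unfolding transvection_def by (rule matrix_works)
qed

lemma transvection_in_U21:
  assumes "herm p p = 0"
  shows "transvection s p \<in> carrier U21"
  using assms
  by (simp add: U21_def transvection_apply herm_add_left herm_add_right herm_scale_left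
      herm_scale_right herm_cnj)

lemma U21_preserves_herm: "A \<in> carrier U21 \<Longrightarrow> herm (A *v z) (A *v w) = herm z w"
  by (simp add: U21_def)

lemma U21_conjugate_transvection:
  assumes A: "A \<in> carrier U21"
  shows "A ** transvection s p = transvection s (A *v p) ** A"
  by (simp add: matrix_eq transvection_apply matrix_vector_right_distrib
      U21_preserves_herm[OF A] vector_scalar_commute flip: matrix_vector_mul_assoc)

lemma tendsto_transvection:
  assumes "q \<longlonglongrightarrow> p"
  shows "(\<lambda>n. transvection s (q n)) \<longlonglongrightarrow> transvection s p"
  unfolding transvection_def matrix_def herm_def
  by (intro vec_tendstoI) (auto intro!: tendsto_intros assms)

lemma group_hom_PU21_class: "group_hom U21 PU21 PU21_class"
proof -
  have "PU21_class \<in> hom U21 PU21"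
    using normal.r_coset_hom_Mod[OF normal_U21_scalars]
    by (simp add: PU21_def PU21_class_def[abs_def])
  then show ?thesis
    by (simp add: group_hom_def group_hom_axioms_def group_U21 group_PU21)
qed

lemma PU21_class_eqD:
  assumes "A \<in> carrier U21" and "PU21_class A = PU21_class B"
  obtains a where "A = mat a ** B"
proof -
  have "A \<in> PU21_class A"
    unfolding PU21_class_def
    using assms(1) normal_U21_scalars group_U21
    by (intro group.rcos_self) (auto simp: normal_def)
  then have "A \<in> PU21_class B" using assms(2) by simp
  then show thesis using that by (auto simp: PU21_class_def r_coset_def U21_scalars_def U21_def)
qed

text \<open>Since \<open>\<theta> < 1\<close>, the sequence stays bounded, and the factors \<open>d n\<close> that tend to zero then
  kill the second term.\<close>
lemma affine_recursion_tendsto: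
  fixes u d :: "nat \<Rightarrow> complex"
  assumes u: "\<And>n. u (Suc n) = a + d n * u n"
    and d: "\<And>n. cmod (d n) \<le> \<theta>" and \<theta>: "\<theta> < 1" and d0: "d \<longlonglongrightarrow> 0"
  shows "u \<longlonglongrightarrow> a"
proof -
  define K where "K = max (cmod (u 0)) (cmod a / (1 - \<theta>))"
  have \<theta>0: "\<theta> \<ge> 0" using d[of 0] norm_ge_zero[of "d 0"] by linarith
  have bound: "cmod (u n) \<le> K" for n
  proof (induction n)
    case (Suc n)
    have step: "cmod (u (Suc n)) \<le> cmod a + \<theta> * K"
      unfolding u using d[of n] Suc \<theta>0
      by (intro norm_triangle_le add_mono order_refl) (simp add: norm_mult mult_mono)
    have "cmod a / (1 - \<theta>) \<le> K" by (simp add: K_def)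
    then have "cmod a \<le> (1 - \<theta>) * K"
      using \<theta> by (simp add: pos_divide_le_eq mult.commute)
    with step show ?case by (simp add: algebra_simps)
  qed (simp add: K_def)
  have "(\<lambda>n. d n * u n) \<longlonglongrightarrow> 0"
  proof (rule Lim_null_comparison)
    show "\<forall>\<^sub>F n in sequentially. norm (d n * u n) \<le> cmod (d n) * K"
      using bound by (simp add: norm_mult mult_left_mono)
    show "(\<lambda>n. cmod (d n) * K) \<longlonglongrightarrow> 0"
      using tendsto_mult_left_zero[OF tendsto_norm_zero[OF d0]] by simp
  qed
  then have "(\<lambda>n. u (Suc n)) \<longlonglongrightarrow> a"
    unfolding u using tendsto_add[OF tendsto_const[of a]] by fastforce
  then show ?thesis by (rule LIMSEQ_imp_Suc)
qed

text \<open>Shimizu's lemma. Let \<open>T\<close> be the transvection along \<open>p\<close>, put \<open>B\<^sub>0 = A\<close> and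
  \<open>B\<^sub>n\<^sub>+\<^sub>1 = B\<^sub>n T B\<^sub>n\<^sup>-\<^sup>1\<close>, the transvection along \<open>q\<^sub>n = B\<^sub>n p\<close>. Because
  \<open>q\<^sub>n\<^sub>+\<^sub>1 = p + \<i> s \<langle>p,q\<^sub>n\<rangle> q\<^sub>n\<close> and \<open>p\<close> is null, the quantity \<open>x\<^sub>n = \<bar>s \<langle>p,q\<^sub>n\<rangle>\<bar>\<close> is squared in
  every step. When it starts strictly between 0 and 1, it tends to 0 without reaching it. So
  \<open>q\<^sub>n\<close> tends to \<open>p\<close> but is never a multiple of it, and the classes of the \<open>B\<^sub>n\<close> accumulate at that of
  \<open>T\<close> without being equal to it.\<close>
theorem shimizu_transvection:
  assumes \<Gamma>: "subgroup \<Gamma> PU21"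
    and p: "herm p p = 0" and T: "PU21_class (transvection s p) \<in> \<Gamma>"
    and A: "A \<in> carrier U21" "PU21_class A \<in> \<Gamma>"
    and pos: "s * cmod (herm p (A *v p)) \<noteq> 0" and less: "\<bar>s\<bar> * cmod (herm p (A *v p)) < 1"
  shows "\<not> discrete_in_PU21 \<Gamma>"
proof
  assume disc: "discrete_in_PU21 \<Gamma>"
  interpret group_hom U21 PU21 PU21_class by (rule group_hom_PU21_class)
  define T where "T = transvection s p"
  define B where "B = rec_nat A (\<lambda>_ X. transvection s (X *v p))"
  define q where "q n = B n *v p" for n
  have B0: "B 0 = A" and BS: "B (Suc n) = transvection s (q n)" for n
    by (simp_all add: B_def q_def)
  have TU: "T \<in> carrier U21" unfolding T_def by (rule transvection_in_U21[OF p])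
  have TT: "T *v p = p" by (simp add: T_def transvection_apply p)
  have BU: "B n \<in> carrier U21" for n
  proof (induction n)
    case (Suc n)
    then have "herm (q n) (q n) = 0" by (simp add: q_def U21_preserves_herm p)
    then show ?case unfolding BS by (rule transvection_in_U21)
  qed (simp add: B0 A)
  have B\<Gamma>: "PU21_class (B n) \<in> \<Gamma>" for n
  proof (induction n)
    case (Suc n)
    have "B (Suc n) \<otimes>\<^bsub>U21\<^esub> B n = B n \<otimes>\<^bsub>U21\<^esub> T"
      using U21_conjugate_transvection[OF BU[of n], of s p]
      by (simp add: U21_def BS q_def T_def)
    then have "PU21_class (B (Suc n)) \<otimes>\<^bsub>PU21\<^esub> PU21_class (B n) =
        PU21_class (B n) \<otimes>\<^bsub>PU21\<^esub> PU21_class T"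
      by (metis BU TU hom_mult)
    then have "PU21_class (B (Suc n)) =
        PU21_class (B n) \<otimes>\<^bsub>PU21\<^esub> PU21_class T \<otimes>\<^bsub>PU21\<^esub> inv\<^bsub>PU21\<^esub> PU21_class (B n)"
      by (metis BU TU H.inv_solve_right H.m_closed hom_closed)
    then show ?case
      using Suc T \<Gamma> by (simp add: T_def subgroup.m_closed subgroup.m_inv_closed)
  qed (simp add: B0 A)
  have qS: "q (Suc n) = p + (\<i> * of_real s * herm p (q n)) *s q n" for n
    unfolding q_def[of "Suc n"] BS by (rule transvection_apply)
  define x where "x n = \<bar>s\<bar> * cmod (herm p (q n))" for n
  have xS: "x (Suc n) = (x n)\<^sup>2" for n
    by (simp add: x_def qS herm_add_right herm_scale_right p norm_mult power2_eq_square)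
  have x0: "0 < x 0" "x 0 < 1"
    using pos less by (simp_all add: x_def q_def B0)
  have xpos: "0 < x n \<and> x n \<le> x 0 ^ Suc n" for n
  proof (induction n)
    case (Suc n)
    then have "x n \<le> x 0" using x0 power_le_one[of "x 0" n]
      by (smt (verit) mult_left_le power_Suc)
    then have "x n * x n \<le> x 0 * x 0 ^ Suc n" using Suc x0 by (intro mult_mono) auto
    then show ?case using Suc by (simp add: xS power2_eq_square)
  qed (simp add: x0)
  have x_le: "x n \<le> x 0" for n
    using xpos[of n] x0 power_le_one[of "x 0" n] by (smt (verit) mult_left_le power_Suc)
  have x_lim: "x \<longlonglongrightarrow> 0"
  proof (rule tendsto_sandwich[OF _ _ tendsto_const])
    show "(\<lambda>n. x 0 ^ Suc n) \<longlonglongrightarrow> 0"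
      using x0 by (intro LIMSEQ_Suc LIMSEQ_realpow_zero) auto
  qed (use xpos in \<open>auto intro!: always_eventually less_imp_le\<close>)
  have "q \<longlonglongrightarrow> p"
  proof (rule vec_tendstoI)
    fix i
    have cm: "cmod (\<i> * of_real s * herm p (q n)) = x n" for n
      by (simp add: x_def norm_mult)
    show "(\<lambda>n. q n $ i) \<longlonglongrightarrow> p $ i"
    proof (rule affine_recursion_tendsto)
      show "q (Suc n) $ i = p $ i + (\<i> * of_real s * herm p (q n)) * q n $ i" for n
        by (simp add: qS)
      show "cmod (\<i> * of_real s * herm p (q n)) \<le> x 0" for n
        using x_le by (simp only: cm)
      show "(\<lambda>n. \<i> * of_real s * herm p (q n)) \<longlonglongrightarrow> 0"
        by (rule tendsto_norm_zero_cancel) (simp only: cm x_lim)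
    qed (rule x0)
  qed
  then have lim: "(\<lambda>n. B (Suc n)) \<longlonglongrightarrow> T"
    unfolding BS T_def by (rule tendsto_transvection)
  have "openin (subtopology PU21_topology \<Gamma>) {PU21_class T}"
    using disc T by (simp add: discrete_in_PU21_def T_def)
  then obtain U where U: "openin PU21_topology U" "{PU21_class T} = U \<inter> \<Gamma>"
    by (auto simp: openin_subtopology)
  then obtain W where W: "open W" "{A \<in> carrier U21. PU21_class A \<in> U} = carrier U21 \<inter> W"
    by (auto simp: openin_PU21_topology openin_open)
  have "T \<in> W" using U(2) W(2) TU by blast
  then obtain n where "B (Suc n) \<in> W"
    using topological_tendstoD[OF lim W(1)] by (auto simp: eventually_sequentially)
  then have "PU21_class (B (Suc n)) \<in> U \<inter> \<Gamma>" using W(2) BU B\<Gamma> by blast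
  then have "PU21_class (B (Suc n)) = PU21_class T" using U(2) by blast
  then obtain a where a: "B (Suc n) = mat a ** T" by (rule PU21_class_eqD[OF BU])
  \<comment> \<open>\<open>T\<close> fixes \<open>p\<close>, hence a matrix in its class maps \<open>p\<close> to a multiple of \<open>p\<close>.\<close>
  have "q (Suc n) = a *s p"
    unfolding q_def a by (simp add: mat_vector_mul TT flip: matrix_vector_mul_assoc)
  then have "herm p (q (Suc n)) = 0" by (simp add: herm_scale_right p)
  then show False using xpos[of "Suc n"] by (simp add: x_def)
qed

section \<open>The product of two reflections of order three\<close>

lemma reflection_map_scale:
  assumes "cmod a = 1"
  shows "reflection_map n (a *s c) = reflection_map n c"
proof -
  have aa: "a * cnj a = 1" using assms by (simp flip: complex_norm_square)
  have "herm (a *s c) (a *s c) = (a * cnj a) * herm c c"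
    by (simp add: herm_scale_left herm_scale_right)
  moreover have "a * herm z (a *s c) = herm z c" for z
    unfolding herm_scale_right using aa by algebra
  ultimately show ?thesis
    by (simp add: fun_eq_iff reflection_map_def aa vec_eq_iff mult_ac)
qed

lemma cube_root_unity:
  defines "\<omega> \<equiv> exp (2 * of_real pi * \<i> / of_nat 3 :: complex)"
  shows "\<omega>\<^sup>2 + \<omega> + 1 = 0" and "\<i> * of_real (sqrt 3) = 2 * \<omega> + 1"
proof -
  have "\<omega> = cis (2 * pi / 3)" by (simp add: \<omega>_def cis_conv_exp mult_ac)
  then have w: "\<omega> = Complex (- 1 / 2) (sqrt 3 / 2)"
    by (simp add: cis.code cos_120 sin_120)
  show "\<omega>\<^sup>2 + \<omega> + 1 = 0" "\<i> * of_real (sqrt 3) = 2 * \<omega> + 1"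
    by (simp_all add: w complex_eq_iff power2_eq_square)
qed

text \<open>Unless \<open>e = c\<close>, the geodesics polar to \<open>e\<close> and \<open>c\<close> are ideal, and \<open>e - c\<close> is their
  common null vector.
  On the quotient of its orthogonal complement by itself, either reflection acts up to sign as
  multiplication by the cube root of unity \<open>\<omega>\<close>, so their product acts as \<open>\<omega>\<^sup>2\<close> and its cube is
  unipotent. The translation length \<open>3 \<surd>3\<close> comes from following the two coordinates
  \<open>U n = \<langle>f\<^sup>n z,e\<rangle>\<close> and \<open>V n = \<langle>f\<^sup>n z,c\<rangle>\<close>, on which \<open>f\<close> acts linearly.\<close>
lemma reflection_product_cube:
  assumes e: "herm e e = 1" and c: "herm c c = 1" and ce: "herm c e = 1"
  defines "f \<equiv> \<lambda>z. reflection_map 3 e (reflection_map 3 c z)"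
  shows "f (f (f z)) = transvection (3 * sqrt 3) (e - c) *v z"
proof -
  define \<omega> where "\<omega> = exp (2 * of_real pi * \<i> / of_nat 3 :: complex)"
  note w = cube_root_unity[folded \<omega>_def]
  have ec: "herm e c = 1" using ce herm_cnj[of c e] by simp
  define k where "k = 1 - \<omega>"
  define X where "X u v = k\<^sup>2 * v - k * u" for u v
  define Y where "Y u v = k * v" for u v :: complex
  have f: "f z = z + X (herm z e) (herm z c) *s e - Y (herm z e) (herm z c) *s c" for z
    unfolding f_def reflection_map_def \<omega>_def[symmetric] k_def[symmetric]
    by (simp add: e c ce herm_add_left herm_minus_left herm_diff_left herm_scale_left X_def Y_def
        vec_eq_iff algebra_simps power2_eq_square)
  have fe: "herm (f z) e = herm z e + X (herm z e) (herm z c) - Y (herm z e) (herm z c)"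
    and fc: "herm (f z) c = herm z c + X (herm z e) (herm z c) - Y (herm z e) (herm z c)" for z
    by (simp_all add: f herm_add_left herm_diff_left herm_scale_left e c ce ec)
  define U where "U n = herm ((f ^^ n) z) e" for n
  define V where "V n = herm ((f ^^ n) z) c" for n
  have U: "U (Suc n) = U n + X (U n) (V n) - Y (U n) (V n)"
    and V: "V (Suc n) = V n + X (U n) (V n) - Y (U n) (V n)" for n
    by (simp_all add: U_def V_def fe fc)
  have k: "k\<^sup>2 = - 3 * \<omega>" using w(1) unfolding k_def by algebra
  have u0: "U 0 = herm z e" and v0: "V 0 = herm z c" by (simp_all add: U_def V_def)
  have step: "U (Suc n) = \<omega> * U n - (1 + 2 * \<omega>) * V n"
    "V (Suc n) = (\<omega> - 1) * U n - 2 * \<omega> * V n" for n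
    unfolding U V X_def Y_def k by (simp_all add: k_def algebra_simps)
  have u1: "U 1 = \<omega> * U 0 - (1 + 2 * \<omega>) * V 0" "V 1 = (\<omega> - 1) * U 0 - 2 * \<omega> * V 0"
    using step[of 0] by simp_all
  have u2: "U 2 = (2 + 2 * \<omega>) * U 0 - (2 + \<omega>) * V 0"
    "V 2 = (1 + 2 * \<omega>) * U 0 - (1 + \<omega>) * V 0"
    using step[of 1] w(1) unfolding u1 Suc_1 by algebra+
  have sumU: "U 0 + U 1 + U 2 = 3 * (1 + \<omega>) * (U 0 - V 0)"
    and sumV: "V 0 + V 1 + V 2 = 3 * \<omega> * (U 0 - V 0)"
    unfolding u1 u2 by (simp_all add: algebra_simps)
  have "Y (U 0) (V 0) + Y (U 1) (V 1) + Y (U 2) (V 2) = k * (V 0 + V 1 + V 2)"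
    by (simp add: Y_def algebra_simps)
  then have sumY: "Y (U 0) (V 0) + Y (U 1) (V 1) + Y (U 2) (V 2) = 3 * (2 * \<omega> + 1) * (U 0 - V 0)"
    unfolding sumV k_def using w(1) by algebra
  have "X (U 0) (V 0) + X (U 1) (V 1) + X (U 2) (V 2) =
      - 3 * \<omega> * (V 0 + V 1 + V 2) - k * (U 0 + U 1 + U 2)"
    unfolding X_def k by (simp add: algebra_simps)
  then have sumX: "X (U 0) (V 0) + X (U 1) (V 1) + X (U 2) (V 2) = 3 * (2 * \<omega> + 1) * (U 0 - V 0)"
    unfolding sumU sumV k_def using w(1) by algebra
  have "f (f (f z)) = z + (X (U 0) (V 0) + X (U 1) (V 1) + X (U 2) (V 2)) *s e
      - (Y (U 0) (V 0) + Y (U 1) (V 1) + Y (U 2) (V 2)) *s c"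
  proof -
    have it: "(f ^^ Suc n) z = (f ^^ n) z + X (U n) (V n) *s e - Y (U n) (V n) *s c" for n
      by (simp add: f U_def V_def)
    have "f (f (f z)) = (f ^^ Suc (Suc (Suc 0))) z" by simp
    then show ?thesis
      unfolding it by (simp add: numeral_2_eq_2 vec_eq_iff algebra_simps)
  qed
  also have "\<dots> = z + (3 * (2 * \<omega> + 1) * (U 0 - V 0)) *s (e - c)"
    unfolding sumX sumY by (simp add: vec_eq_iff algebra_simps)
  also have "\<dots> = transvection (3 * sqrt 3) (e - c) *v z"
    by (simp add: transvection_apply u0 v0 herm_diff_right mult.assoc flip: w(2))
      (simp add: mult.left_commute)
  finally show ?thesis .
qed

section \<open>Triangle groups\<close>

theorem proposition2:
  fixes m \<alpha> :: real and \<Gamma> :: "(complex^3^3) set set"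
  assumes "m \<ge> 0"
    and "0 < \<alpha>" and "\<alpha> < 2 * pi"
    and "is_triangle_group m m 0 3 3 2 \<alpha> \<Gamma>"
    and "cos \<alpha> > 1 - 1 / (12 * sqrt 3 * (cosh (m / 2))\<^sup>2)"
  shows "\<not> discrete_in_PU21 \<Gamma>"
proof -
  obtain C1 C2 C3 c1 c2 c3 where tri: "is_triangle m m 0 C1 C2 C3"
    and pol: "normalised_polar c1 C1" "normalised_polar c2 C2" "normalised_polar c3 C3"
    and \<alpha>: "\<alpha> = angular_invariant c1 c2 c3"
    and \<Gamma>: "\<Gamma> = generate PU21
      {minimal_reflection 3 c1, minimal_reflection 3 c2, minimal_reflection 2 c3}"
    using assms(4) unfolding is_triangle_group_def by blast
  have n: "herm c1 c1 = 1" "herm c2 c2 = 1" "herm c3 c3 = 1"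
    and C: "C1 = polar_line c1" "C2 = polar_line c2" "C3 = polar_line c3"
    using pol by (simp_all add: normalised_polar_def)
  define r where "r = cosh (m / 2)"
  have r32: "cmod (herm c3 c2) = r"
    using tri cosh_half_dist_of_pair[OF n(3) n(2)] unfolding is_triangle_def C r_def by metis
  have r13: "cmod (herm c1 c3) = r"
    using tri cosh_half_dist_of_pair[OF n(1) n(3)] unfolding is_triangle_def C r_def by metis
  have r21: "cmod (herm c2 c1) = cosh (0 / 2)"
    using tri cosh_half_dist_of_pair[OF n(2) n(1)] unfolding is_triangle_def C by metis
  have r0: "r > 0" by (simp add: r_def)
  \<comment> \<open>Rescaling \<open>c1\<close> by \<open>h\<close> makes its product with \<open>c2\<close> equal to 1 and does not change its reflection.\<close>
  define h where "h = herm c2 c1"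
  have h: "cmod h = 1" using r21 by (simp add: h_def)
  then have hh: "h * cnj h = 1" by (simp flip: complex_norm_square)
  define e where "e = h *s c1"
  define p where "p = e - c2"
  have ee: "herm e e = 1" using hh by (simp add: e_def herm_scale_left herm_scale_right n mult.commute)
  have c2e: "herm c2 e = 1"
    using hh by (metis e_def h_def herm_scale_right mult.commute)
  have ec2: "herm e c2 = 1" using c2e herm_cnj[of c2 e] by simp
  have pp: "herm p p = 0" by (simp add: p_def herm_diff_left herm_diff_right ee c2e ec2 n)

  have Re_prod: "Re (herm c3 c2 * herm c1 c3 * herm c2 c1) = r\<^sup>2 * cos \<alpha>"
    using cos_Arg2pi[of "herm c3 c2 * herm c1 c3 * herm c2 c1"]
    by (simp add: \<alpha> angular_invariant_def norm_mult r32 r13 r21 power2_eq_square)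
  have pc3: "(cmod (herm p c3))\<^sup>2 = 2 * r\<^sup>2 * (1 - cos \<alpha>)"
  proof -
    have "herm p c3 = h * herm c1 c3 - herm c2 c3"
      by (simp add: p_def e_def herm_diff_left herm_scale_left)
    then have "(cmod (herm p c3))\<^sup>2 = (cmod (h * herm c1 c3))\<^sup>2 + (cmod (herm c2 c3))\<^sup>2
        - 2 * Re (h * herm c1 c3 * cnj (herm c2 c3))"
      by (simp add: cmod_power2) (simp add: power2_eq_square algebra_simps)
    also have "h * herm c1 c3 * cnj (herm c2 c3) = herm c3 c2 * herm c1 c3 * herm c2 c1"
      by (simp add: h_def herm_cnj)
    also have "Re (herm c3 c2 * herm c1 c3 * herm c2 c1) = r\<^sup>2 * cos \<alpha>"
      by (rule Re_prod)
    also have "cmod (h * herm c1 c3) = r" by (simp add: norm_mult h r13)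
    also have "cmod (herm c2 c3) = r" using r32 by (metis complex_mod_cnj herm_cnj)
    finally show ?thesis by (simp add: algebra_simps)
  qed

  define M where "M n c = matrix (reflection_map n c)" for n c
  have MU: "M 3 c1 \<in> carrier U21" "M 3 c2 \<in> carrier U21" "M 2 c3 \<in> carrier U21"
    unfolding M_def by (simp_all add: reflection_in_U21 n)
  interpret group_hom U21 PU21 PU21_class by (rule group_hom_PU21_class)
  have gens: "{minimal_reflection 3 c1, minimal_reflection 3 c2, minimal_reflection 2 c3} \<subseteq> carrier PU21"
    by (simp add: minimal_reflection_in_PU21 n)
  have sub: "subgroup \<Gamma> PU21" unfolding \<Gamma> by (rule H.generate_is_subgroup[OF gens])
  have in\<Gamma>: "PU21_class (M 3 c1) \<in> \<Gamma>" "PU21_class (M 3 c2) \<in> \<Gamma>" "PU21_class (M 2 c3) \<in> \<Gamma>"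
    unfolding \<Gamma> M_def minimal_reflection_def by (auto intro: generate.incl)
  define P where "P = M 3 c1 \<otimes>\<^bsub>U21\<^esub> M 3 c2"
  have PU: "P \<in> carrier U21" unfolding P_def using MU by simp
  have P\<Gamma>: "PU21_class P \<in> \<Gamma>"
    unfolding P_def using MU in\<Gamma> sub by (simp add: subgroup.m_closed)
  have "P *v z = reflection_map 3 e (reflection_map 3 c2 z)" for z
    by (simp add: P_def M_def U21_def matrix_reflection_map e_def reflection_map_scale[OF h]
        flip: matrix_vector_mul_assoc)
  then have "transvection (3 * sqrt 3) p = P \<otimes>\<^bsub>U21\<^esub> (P \<otimes>\<^bsub>U21\<^esub> P)"
    using reflection_product_cube[OF ee n(2) c2e]
    by (simp add: matrix_eq U21_def p_def flip: matrix_vector_mul_assoc)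
  then have T\<Gamma>: "PU21_class (transvection (3 * sqrt 3) p) \<in> \<Gamma>"
    using PU P\<Gamma> sub by (simp add: subgroup.m_closed)

  have "M 2 c3 *v p = - p + (2 * herm p c3) *s c3"
    by (simp add: M_def matrix_reflection_map reflection_map_def n)
  then have "herm p (M 2 c3 *v p) = 2 * (herm p c3 * herm c3 p)"
    by (simp add: herm_diff_right herm_scale_right pp herm_cnj)
  also have "herm p c3 * herm c3 p = of_real ((cmod (herm p c3))\<^sup>2)"
    using complex_norm_square[of "herm p c3"] by (simp add: herm_cnj)
  finally have "cmod (herm p (M 2 c3 *v p)) = 2 * (cmod (herm p c3))\<^sup>2"
    by (simp add: norm_mult norm_power)
  then have val: "cmod (herm p (M 2 c3 *v p)) = 4 * r\<^sup>2 * (1 - cos \<alpha>)" by (simp add: pc3)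

  have "cos \<alpha> \<noteq> 1"
  proof
    assume "cos \<alpha> = 1"
    then obtain k :: int where "\<alpha> = of_int k * (2 * pi)" by (auto simp: cos_one_2pi_int)
    then show False using assms(2,3) 
      by (smt (verit) mult_less_cancel_right2 of_int_less_1_iff pi_gt_zero zero_less_mult_iff of_int_0_less_iff)
  qed
  then have pos: "4 * r\<^sup>2 * (1 - cos \<alpha>) \<noteq> 0" using r0 by simp
  have "1 - cos \<alpha> < 1 / (12 * sqrt 3 * r\<^sup>2)" using assms(5) by (simp add: r_def)
  then have "3 * sqrt 3 * (4 * r\<^sup>2 * (1 - cos \<alpha>)) < 1"
    using r0 by (simp add: field_simps)
  then show ?thesis
    using pos by (intro shimizu_transvection[OF sub pp T\<Gamma> MU(3) in\<Gamma>(3)]) (simp_all add: val)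
qed

end
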